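(* Let $\mathcal{X}$ be an order $N$ real tensor all of whose dimensions equal $s$, let $A^{(n)}=A_p^{(n)}+dA^{(n)}\in\mathbb{R}^{s\times R}$, $n\in\{1,\ldots,N\}$, be the current Tucker factor matrices (with orthonormal columns), where $A_p^{(n)}$ (also with orthonormal columns) are the factor matrices at the time the pairwise perturbation operators were formed, and let $\delta A^{(N)}=A^{(N)}_{\mathrm{new}}-A^{(N)}$ be the change of the $N$-th factor matrix in a Tucker-ALS update. Suppose $\|da_k^{(n)}\|_2/\|a_k^{(n)}\|_2\le\epsilon<1$ for all $n\in\{1,\ldots,N\}$ and $k\in\{1,\ldots,R\}$. Then the pairwise perturbation algorithm computes the update $\mathcal{J}^{(1,N)}$ with error, for all $i_2,\ldots,i_N\in\{1,\ldots,R\}$, $$\big\|\tilde j^{(1,N)}_{i_2,\ldots,i_N}-j^{(1,N)}_{i_2,\ldots,i_N}\big\|_2=O(N\epsilon)\,\|\hat{\mathcal{T}}\|_2\prod_{j=2}^{N-1}\|a_{i_j}^{(j)}\|_2,\qquad \hat{\mathcal{T}}=\mathcal{X}\times_N\delta a_{i_N}^{(N)T},$$ where $j^{(1,N)}_{i_2,\ldots,i_N}(x)=\mathcal{J}^{(1,N)}(x,i_2,\ldots,i_N)$ and $\tilde j^{(1,N)}_{i_2,\ldots,i_N}(x)=\tilde{\mathcal{J}}^{(1,N)}(x,i_2,\ldots,i_N)$.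
   Context: Lower-case $a_k^{(l)}, da_k^{(l)},\delta a_k^{(l)}$ denote the $k$-th columns of $A^{(l)},dA^{(l)},\delta A^{(l)}$. $\mathcal{X}\times_n B$ denotes the mode-$n$ product with a matrix $B\in\mathbb{R}^{J\times s_n}$; for a vector $v$, $\mathcal{X}\times_n v^T$ is the contraction of mode $n$ with $v$ (mode $n$ is removed). Spectral norm of a tensor $\mathcal{T}$ of order $M$: $\|\mathcal{T}\|_2=\max \|\mathcal{T}\times_2 x^{(2)T}\cdots\times_M x^{(M)T}\|_2$ over unit vectors $x^{(2)},\ldots,x^{(M)}$ (invariant under reordering of modes). Tucker-ALS: the $n$-th factor is updated by taking $A^{(n)}_{\mathrm{new}}$ to have as columns the $R$ leading left singular vectors of the mode-$n$ unfolding of $\mathcal{Y}^{(n)}=\mathcal{X}$ multiplied by $A^{(j)T}$ along every mode $j\neq n$. Let $\mathcal{Y}^{(1,N)}=\mathcal{X}\times_2A^{(2)T}\cdots\times_{N-1}A^{(N-1)T}$ and $\mathcal{Y}_p^{(1,N)}=\mathcal{X}\times_2A_p^{(2)T}\cdots\times_{N-1}A_p^{(N-1)T}$ (the pairwise perturbation operator). The exact update to $\mathcal{Y}^{(1)}$ due to $\delta A^{(N)}$ is $\mathcal{J}^{(1,N)}=\mathcal{Y}^{(1,N)}\times_N\delta A^{(N)T}$ and the update computed by pairwise perturbation is $\tilde{\mathcal{J}}^{(1,N)}=\mathcal{Y}_p^{(1,N)}\times_N\delta A^{(N)T}$. The symbol $O(N\epsilon)$ is meant to leading order as $N\epsilon\to0$: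 there are absolute constants $C,c>0$ (independent of $N$, $s$, $R$, the tensor and the factors) such that whenever $N\epsilon\le c$ the left-hand side is at most $CN\epsilon$ times the remaining factors. *)

theory Defs
  imports Complex_Main "Jordan_Normal_Form.Matrix"
begin

text \<open>
  A tensor is given by its entries, as a function of multi-indices. A multi-index of a tensor with
  mode set \<open>K\<close> and dimensions \<open>d\<close> is an element of \<open>PiE K (\<lambda>k. {..<d k})\<close>: mode labels are
  positive natural numbers, entry positions within a mode start at 0, and only the entries at such
  extensional multi-indices matter. As in \<open>X \<times>_2 \<dots> \<times>_N\<close>, the remaining
  modes keep their labels when some mode is contracted with a vector.
\<close>

type_synonym tensor = "(nat \<Rightarrow> nat) \<Rightarrow> real"

definition vec_nrm2 :: "real vec \<Rightarrow> real" where
  "vec_nrm2 v = sqrt (v \<bullet> v)"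

definition orthonormal_cols :: "real mat \<Rightarrow> bool" where
  "orthonormal_cols A \<longleftrightarrow> transpose_mat A * A = 1\<^sub>m (dim_col A)"

definition mode_prod :: "tensor \<Rightarrow> nat \<Rightarrow> real mat \<Rightarrow> tensor" where
  "mode_prod X n B = (\<lambda>i. \<Sum>t<dim_col B. B $$ (i n, t) * X (i(n := t)))"

text \<open>The result of \<open>X \<times>_n v^T\<close> does not depend on the index in mode \<open>n\<close>, which is removed.\<close>

definition mode_contract :: "tensor \<Rightarrow> nat \<Rightarrow> real vec \<Rightarrow> tensor" where
  "mode_contract X n v = (\<lambda>i. \<Sum>t<dim_vec v. v $ t * X (i(n := t)))"

definition mode_prods_transpose :: "tensor \<Rightarrow> nat list \<Rightarrow> (nat \<Rightarrow> real mat) \<Rightarrow> tensor" where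
  "mode_prods_transpose X ns A = fold (\<lambda>n Y. mode_prod Y n (transpose_mat (A n))) ns X"

definition mode_contracts :: "tensor \<Rightarrow> nat list \<Rightarrow> (nat \<Rightarrow> real vec) \<Rightarrow> tensor" where
  "mode_contracts X ns x = fold (\<lambda>n Y. mode_contract Y n (x n)) ns X"

text \<open>
  The mode-1 fiber of a tensor at a given choice of the other indices, for first dimension \<open>d\<close>.
\<close>

definition mode1_fiber :: "nat \<Rightarrow> tensor \<Rightarrow> (nat \<Rightarrow> nat) \<Rightarrow> real vec" where
  "mode1_fiber d X i = vec d (\<lambda>x. X (i(1 := x)))"

text \<open>
  Spectral norm of a tensor with modes \<open>1, \<dots>, M\<close> and dimensions \<open>d 1, \<dots>, d M\<close>. For positive
  dimensions the supremum is a maximum, since a continuous function is maximised over a product of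
  unit spheres. After contracting modes \<open>2, \<dots>, M\<close> only mode 1 is left, so the fiber is taken at the
  empty multi-index \<open>\<lambda>_. undefined\<close>.
\<close>

definition tensor_spectral_norm :: "nat \<Rightarrow> (nat \<Rightarrow> nat) \<Rightarrow> tensor \<Rightarrow> real" where
  "tensor_spectral_norm M d T =
     Sup {vec_nrm2 (mode1_fiber (d 1) (mode_contracts T [2..<Suc M] x) (\<lambda>_. undefined)) | x.
            \<forall>n\<in>{2..M}. x n \<in> carrier_vec (d n) \<and> vec_nrm2 (x n) = 1}"

text \<open>
  Mode-\<open>n\<close> unfolding of a tensor with modes \<open>1, \<dots>, N\<close>. The multi-index of the modes
  \<open>k \<noteq> n\<close> belonging to column \<open>c\<close> is the mixed-radix expansion of \<open>c\<close>, lower modes varying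
  fastest.
\<close>

definition mode_unfolding :: "nat \<Rightarrow> (nat \<Rightarrow> nat) \<Rightarrow> nat \<Rightarrow> tensor \<Rightarrow> real mat" where
  "mode_unfolding N d n Y =
     mat (d n) (\<Prod>k\<in>{1..N} - {n}. d k)
       (\<lambda>(r, c). Y (\<lambda>k\<in>{1..N}. if k = n then r
                              else (c div (\<Prod>m\<in>{1..<k} - {n}. d m)) mod d k))"

text \<open>Full singular value decomposition, with the singular values in non-increasing order.\<close>

definition is_svd :: "real mat \<Rightarrow> real mat \<Rightarrow> real mat \<Rightarrow> real mat \<Rightarrow> bool" where
  "is_svd M U S V \<longleftrightarrow>
     U \<in> carrier_mat (dim_row M) (dim_row M) \<and> orthonormal_cols U \<and>
     V \<in> carrier_mat (dim_col M) (dim_col M) \<and> orthonormal_cols V \<and>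
     S \<in> carrier_mat (dim_row M) (dim_col M) \<and> diagonal_mat S \<and>
     (\<forall>i < min (dim_row M) (dim_col M). 0 \<le> S $$ (i, i)) \<and>
     (\<forall>i j. i \<le> j \<longrightarrow> j < min (dim_row M) (dim_col M) \<longrightarrow> S $$ (j, j) \<le> S $$ (i, i)) \<and>
     M = U * S * transpose_mat V"

text \<open>
  Leading left singular vectors are in general not unique, so this is a relation: the columns
  of \<open>B\<close> are the first \<open>R\<close> left singular vectors of some singular value decomposition of \<open>M\<close>.
\<close>

definition leading_left_singular_vectors :: "nat \<Rightarrow> real mat \<Rightarrow> real mat \<Rightarrow> bool" where
  "leading_left_singular_vectors R M B \<longleftrightarrow>
     R \<le> dim_row M \<and> B \<in> carrier_mat (dim_row M) R \<and>
     (\<exists>U S V. is_svd M U S V \<and> (\<forall>k<R. col B k = col U k))"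

text \<open>
  \<open>B\<close> is a possible value of the new \<open>n\<close>-th factor in a Tucker-ALS update of the factors \<open>A\<close> for
  the order \<open>N\<close> tensor \<open>X\<close> with all dimensions \<open>s\<close> and all Tucker ranks \<open>R\<close>. The tensor that
  is unfolded has dimension \<open>s\<close> in mode \<open>n\<close> and \<open>R\<close> in the other modes.
\<close>

definition tucker_als_update ::
    "nat \<Rightarrow> nat \<Rightarrow> nat \<Rightarrow> tensor \<Rightarrow> (nat \<Rightarrow> real mat) \<Rightarrow> nat \<Rightarrow> real mat \<Rightarrow> bool" where
  "tucker_als_update N s R X A n B \<longleftrightarrow>
     leading_left_singular_vectors R
       (mode_unfolding N ((\<lambda>_. R)(n := s)) n
          (mode_prods_transpose X (filter (\<lambda>j. j \<noteq> n) [1..<Suc N]) A))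
       B"

text \<open>
  The tensor \<open>Y^(1,N) = X \<times>_2 A^(2)T \<dots> \<times>_(N-1) A^(N-1)T\<close>; at the factors \<open>A_p\<close> it is the pairwise
  perturbation operator.
\<close>

definition Y1N :: "nat \<Rightarrow> tensor \<Rightarrow> (nat \<Rightarrow> real mat) \<Rightarrow> tensor" where
  "Y1N N X A = mode_prods_transpose X [2..<N] A"

text \<open>
  The update of \<open>Y^(1)\<close> due to the change \<open>D\<close> of the \<open>N\<close>-th factor, with \<open>Y^(1,N)\<close>
  evaluated at the factors \<open>A\<close>: the exact update for the current factors, the pairwise
  perturbation update for the factors \<open>A_p\<close>.
\<close>

definition J1N :: "nat \<Rightarrow> tensor \<Rightarrow> (nat \<Rightarrow> real mat) \<Rightarrow> real mat \<Rightarrow> tensor" where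
  "J1N N X A D = mode_prod (Y1N N X A) N (transpose_mat D)"

end

theory Submission
  imports Defs "HOL-Analysis.L2_Norm"
begin

text \<open>
  Since contractions of different modes commute, \<open>j^(1,N)\<close> at \<open>(i_2, \<dots>, i_N)\<close> is the multilinear
  map defined by \<open>T = X \<times>_N \<delta>a^T\<close> evaluated at the unit vectors \<open>a^(j)\<close>, and the
  approximation is its value at the unit vectors \<open>a_p^(j)\<close>. Exchanging the arguments one at a time
  costs at most \<open>\<epsilon>\<close> times the spectral norm of \<open>T\<close> per mode, hence at most \<open>N \<epsilon>\<close> times it in
  total.
\<close>

section \<open>Euclidean norm of vectors and unit columns\<close>

lemma vec_nrm2_L2_set: "vec_nrm2 v = L2_set (\<lambda>t. v $ t) {..<dim_vec v}"
  by (simp add: vec_nrm2_def L2_set_def scalar_prod_def power2_eq_square lessThan_atLeast0)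

lemma vec_nrm2_nonneg: "0 \<le> vec_nrm2 v"
  by (simp add: vec_nrm2_L2_set L2_set_nonneg)

lemma vec_nrm2_smult: "vec_nrm2 (c \<cdot>\<^sub>v v) = \<bar>c\<bar> * vec_nrm2 v"
  by (simp add: vec_nrm2_L2_set L2_set_def power_mult_distrib real_sqrt_mult
      flip: sum_distrib_left)

lemma abs_index_le_vec_nrm2: "t < dim_vec v \<Longrightarrow> \<bar>v $ t\<bar> \<le> vec_nrm2 v"
  using member_le_L2_set[of "{..<dim_vec v}" t "\<lambda>t. \<bar>v $ t\<bar>"]
  by (simp add: vec_nrm2_L2_set L2_set_def)

lemma vec_nrm2_triangle:
  assumes "dim_vec v = dim_vec w"
  shows "vec_nrm2 (v + w) \<le> vec_nrm2 v + vec_nrm2 w"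
  using L2_set_triangle_ineq[of "\<lambda>t. v $ t" "\<lambda>t. w $ t" "{..<dim_vec w}"] assms
  by (simp add: vec_nrm2_L2_set L2_set_def)

lemma vec_nrm2_mono:
  assumes "dim_vec v = dim_vec w" "\<And>t. t < dim_vec w \<Longrightarrow> \<bar>v $ t\<bar> \<le> w $ t"
  shows "vec_nrm2 v \<le> vec_nrm2 w"
proof -
  have "L2_set (\<lambda>t. \<bar>v $ t\<bar>) {..<dim_vec w} \<le> L2_set (\<lambda>t. w $ t) {..<dim_vec w}"
    using assms by (intro L2_set_mono) auto
  then show ?thesis
    using assms(1) by (simp add: vec_nrm2_L2_set L2_set_def)
qed

lemma orthonormal_cols_vec_nrm2_col:
  assumes "orthonormal_cols A" "k < dim_col A"
  shows "vec_nrm2 (col A k) = 1"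
proof -
  have "col A k \<bullet> col A k = (transpose_mat A * A) $$ (k, k)"
    using assms(2) by simp
  also have "\<dots> = 1"
    unfolding assms(1)[unfolded orthonormal_cols_def] using assms(2) by simp
  finally show ?thesis
    by (simp add: vec_nrm2_def)
qed

section \<open>Multilinear algebra of mode contractions\<close>

lemma mode_contract_add:
  assumes "dim_vec v = dim_vec w"
  shows "mode_contract X n (v + w) i = mode_contract X n v i + mode_contract X n w i"
  using assms by (simp add: mode_contract_def sum.distrib algebra_simps)

lemma mode_contract_commute:
  assumes "m \<noteq> n"
  shows "mode_contract (mode_contract X m v) n w = mode_contract (mode_contract X n w) m v"
proof
  fix i
  have "mode_contract (mode_contract X m v) n w i
      = (\<Sum>t<dim_vec w. \<Sum>u<dim_vec v. v $ u * (w $ t * X (i(m := u, n := t))))"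
    using assms by (simp add: mode_contract_def sum_distrib_left fun_upd_twist mult_ac)
  also have "\<dots> = mode_contract (mode_contract X n w) m v i"
    by (subst sum.swap) (simp add: mode_contract_def sum_distrib_left)
  finally show "mode_contract (mode_contract X m v) n w i
      = mode_contract (mode_contract X n w) m v i" .
qed

text \<open>Fixing the index in mode \<open>n\<close> selects one column of \<open>B\<close>; this
  passes from matrix products to vector contractions.\<close>

lemma mode_prod_transpose:
  assumes "i n < dim_col B"
  shows "mode_prod X n (transpose_mat B) i = mode_contract X n (col B (i n)) i"
  using assms by (simp add: mode_prod_def mode_contract_def)

lemma mode_contracts_Nil [simp]: "mode_contracts X [] x = X"
  by (simp add: mode_contracts_def)

lemma mode_contracts_Cons [simp]:
  "mode_contracts X (n # ns) x = mode_contracts (mode_contract X n (x n)) ns x"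
  by (simp add: mode_contracts_def)

lemma mode_contracts_snoc [simp]:
  "mode_contracts X (ns @ [n]) x = mode_contract (mode_contracts X ns x) n (x n)"
  by (simp add: mode_contracts_def)

lemma mode_contracts_cong:
  assumes "\<And>n. n \<in> set ns \<Longrightarrow> x n = y n"
  shows "mode_contracts X ns x = mode_contracts X ns y"
  using assms by (induction ns arbitrary: X) auto

lemma mode_contract_mode_contracts:
  assumes "n \<notin> set ns"
  shows "mode_contract (mode_contracts X ns x) n v = mode_contracts (mode_contract X n v) ns x"
  using assms by (induction ns arbitrary: X) (auto simp: mode_contract_commute)

text \<open>Contractions in different modes commute, so the one in mode \<open>n\<close> can be
  performed last, where the linear dependence on \<open>x n\<close> is visible.\<close>

lemma mode_contracts_extract:
  assumes "distinct ns" "n \<in> set ns"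
  shows "mode_contracts X ns x = mode_contract (mode_contracts X (remove1 n ns) x) n (x n)"
  using assms
  by (induction ns arbitrary: X) (auto simp: mode_contract_mode_contracts mode_contract_commute[where n = n])

lemma mode_contracts_add:
  assumes "distinct ns" "n \<in> set ns" "dim_vec v = dim_vec w"
  shows "mode_contracts X ns (x(n := v + w)) i
    = mode_contracts X ns (x(n := v)) i + mode_contracts X ns (x(n := w)) i"
proof -
  \<comment> \<open>Once \<open>n\<close> is removed from the list, the inner contractions no longer
    see the vector placed at \<open>n\<close>; only the outer one depends on
    \<open>u\<close>.\<close>
  have "mode_contracts X ns (x(n := u))
      = mode_contract (mode_contracts X (remove1 n ns) x) n u" for u
    using assms mode_contracts_cong[of "remove1 n ns" "x(n := u)" x]
    by (subst mode_contracts_extract[of ns n]) auto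
  then show ?thesis
    using assms(3) by (simp add: mode_contract_add)
qed

lemma mode_contracts_smult:
  assumes "distinct ns"
  shows "mode_contracts X ns (\<lambda>n. c n \<cdot>\<^sub>v x n) i = (\<Prod>n\<in>set ns. c n) * mode_contracts X ns x i"
  using assms
  by (induction ns arbitrary: i rule: rev_induct)
    (auto simp: mode_contract_def sum_distrib_left mult_ac intro!: sum.cong)

text \<open>Each contraction overwrites the index in its own mode by the summation variable, so the
  incoming value there is forgotten.\<close>

lemma mode_contracts_index_cong:
  assumes "\<And>k. k \<notin> set ns \<Longrightarrow> i k = j k"
  shows "mode_contracts X ns x i = mode_contracts X ns x j"
  using assms
proof (induction ns arbitrary: i j rule: rev_induct)
  case Nil
  then have "i = j" by auto
  then show ?case by simp
next
  case (snoc n ns)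
  have "mode_contracts X ns x (i(n := t)) = mode_contracts X ns x (j(n := t))" for t
    using snoc.prems by (intro snoc.IH) auto
  then show ?case
    by (simp add: mode_contract_def)
qed

text \<open>Triangle inequality with weights at most 1: the right-hand side is a plain sum of
  absolute entries, hence a crude bound that is uniform in \<open>x\<close>.\<close>

lemma abs_mode_contracts_le:
  assumes "\<And>n. n \<in> set ns \<Longrightarrow> dim_vec (x n) = d n"
    and "\<And>n t. n \<in> set ns \<Longrightarrow> t < d n \<Longrightarrow> \<bar>x n $ t\<bar> \<le> 1"
  shows "\<bar>mode_contracts X ns x i\<bar>
    \<le> mode_contracts (\<lambda>i. \<bar>X i\<bar>) ns (\<lambda>n. vec (d n) (\<lambda>_. 1)) i"
  using assms
proof (induction ns arbitrary: i rule: rev_induct)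
  case (snoc n ns)
  let ?Z = "mode_contracts (\<lambda>i. \<bar>X i\<bar>) ns (\<lambda>n. vec (d n) (\<lambda>_. 1))"
  have "\<bar>x n $ t * mode_contracts X ns x (i(n := t))\<bar> \<le> ?Z (i(n := t))" if "t < d n" for t
    using mult_mono[of "\<bar>x n $ t\<bar>" 1 "\<bar>mode_contracts X ns x (i(n := t))\<bar>" "?Z (i(n := t))"]
      snoc that
    by (auto simp: abs_mult)
  then have "\<bar>\<Sum>t<d n. x n $ t * mode_contracts X ns x (i(n := t))\<bar> \<le> (\<Sum>t<d n. ?Z (i(n := t)))"
    by (intro order_trans[OF sum_abs] sum_mono) auto
  then show ?case
    using snoc.prems(1) by (simp add: mode_contract_def)
qed simp

lemma mode_prods_transpose_eq_contracts:
  assumes "distinct ns" "\<And>n. n \<in> set ns \<Longrightarrow> i n < dim_col (A n)"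
  shows "mode_prods_transpose X ns A i = mode_contracts X ns (\<lambda>n. col (A n) (i n)) i"
  using assms
proof (induction ns arbitrary: i rule: rev_induct)
  case (snoc n ns)
  \<comment> \<open>By distinctness \<open>n\<close> is not in \<open>ns\<close>, so replacing
    \<open>i n\<close> by \<open>t\<close> leaves the columns selected in the modes
    \<open>ns\<close> unchanged.\<close>
  have "mode_prods_transpose X ns A (i(n := t))
      = mode_contracts X ns (\<lambda>k. col (A k) (i k)) (i(n := t))" for t
  proof -
    have "mode_contracts X ns (\<lambda>k. col (A k) ((i(n := t)) k))
        = mode_contracts X ns (\<lambda>k. col (A k) (i k))"
      using snoc.prems by (intro mode_contracts_cong) auto
    moreover have "mode_prods_transpose X ns A (i(n := t))
        = mode_contracts X ns (\<lambda>k. col (A k) ((i(n := t)) k)) (i(n := t))"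
      using snoc.prems by (intro snoc.IH) auto
    ultimately show ?thesis by simp
  qed
  then show ?case
    using snoc.prems
    by (simp add: mode_prods_transpose_def mode_prod_transpose) (simp add: mode_contract_def)
qed (simp add: mode_prods_transpose_def)

section \<open>The spectral norm as a bound for contractions with arbitrary vectors\<close>

lemma bdd_above_tensor_spectral_norm:
  "bdd_above {vec_nrm2 (mode1_fiber (d 1) (mode_contracts T [2..<Suc M] x) (\<lambda>_. undefined)) | x.
     \<forall>n\<in>{2..M}. x n \<in> carrier_vec (d n) \<and> vec_nrm2 (x n) = 1}"
proof (rule bdd_aboveI)
  \<comment> \<open>Entries of a unit vector are at most 1 in absolute value, so contracting the
    absolute values of \<open>T\<close> with all-ones vectors dominates every element of the
    set.\<close>
  let ?b = "vec_nrm2 (mode1_fiber (d 1)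
    (mode_contracts (\<lambda>i. \<bar>T i\<bar>) [2..<Suc M] (\<lambda>n. vec (d n) (\<lambda>_. 1))) (\<lambda>_. undefined))"
  fix r
  assume "r \<in> {vec_nrm2 (mode1_fiber (d 1) (mode_contracts T [2..<Suc M] x) (\<lambda>_. undefined)) | x.
     \<forall>n\<in>{2..M}. x n \<in> carrier_vec (d n) \<and> vec_nrm2 (x n) = 1}"
  then obtain x where
    r: "r = vec_nrm2 (mode1_fiber (d 1) (mode_contracts T [2..<Suc M] x) (\<lambda>_. undefined))"
    and x: "\<And>n. n \<in> {2..M} \<Longrightarrow> x n \<in> carrier_vec (d n) \<and> vec_nrm2 (x n) = 1"
    by blast
  have dim: "dim_vec (x n) = d n" if "n \<in> set [2..<Suc M]" for n
    using x[of n] that by auto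
  have le1: "\<bar>x n $ t\<bar> \<le> 1" if "n \<in> set [2..<Suc M]" "t < d n" for n t
    using x[of n] that abs_index_le_vec_nrm2[of t "x n"] by auto
  show "r \<le> ?b"
    unfolding r
    using abs_mode_contracts_le[of "[2..<Suc M]" x d T, OF dim le1]
    by (intro vec_nrm2_mono) (auto simp: mode1_fiber_def simp del: upt_Suc)
qed

text \<open>Normalise every argument and pull the norms out by multilinearity. The extension from
  unit vectors is what permits a difference of two columns as an argument.\<close>

lemma vec_nrm2_mode_contracts_le:
  assumes "\<And>n. n \<in> {2..M} \<Longrightarrow> x n \<in> carrier_vec (d n)"
  shows "vec_nrm2 (mode1_fiber (d 1) (mode_contracts T [2..<Suc M] x) (\<lambda>_. undefined))
    \<le> tensor_spectral_norm M d T * (\<Prod>n\<in>{2..M}. vec_nrm2 (x n))"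
proof -
  define c where "c n = vec_nrm2 (x n)" for n
  \<comment> \<open>If \<open>c n = 0\<close>, then \<open>1 / c n = 0\<close>, so
    \<open>u n\<close> is a zero vector rather than a unit vector; as \<open>x n\<close> is zero
    too, \<open>x n\<close> is still \<open>c n\<close> times \<open>u n\<close>.\<close>
  define u where "u n = (1 / c n) \<cdot>\<^sub>v x n" for n
  let ?F = "\<lambda>x. vec_nrm2 (mode1_fiber (d 1) (mode_contracts T [2..<Suc M] x) (\<lambda>_. undefined))"
  have set: "set [2..<Suc M] = {2..M}" by auto
  have "x n = c n \<cdot>\<^sub>v u n" for n
  proof (cases "c n = 0")
    case True
    then have "x n $ t = 0" if "t < dim_vec (x n)" for t
      using abs_index_le_vec_nrm2[OF that] by (simp add: c_def)
    then show ?thesis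
      using True by (intro eq_vecI) (auto simp: u_def)
  qed (auto simp: u_def smult_smult_assoc)
  then have x: "(\<lambda>n. c n \<cdot>\<^sub>v u n) = x" by auto
  have "mode_contracts T [2..<Suc M] x i
      = (\<Prod>n\<in>{2..M}. c n) * mode_contracts T [2..<Suc M] u i" for i
    using mode_contracts_smult[OF distinct_upt, of T 2 "Suc M" c u i] unfolding set x .
  then have "mode1_fiber (d 1) (mode_contracts T [2..<Suc M] x) (\<lambda>_. undefined)
      = (\<Prod>n\<in>{2..M}. c n) \<cdot>\<^sub>v mode1_fiber (d 1) (mode_contracts T [2..<Suc M] u) (\<lambda>_. undefined)"
    by (intro eq_vecI)
      (simp_all add: mode1_fiber_def del: upt_Suc)
  then have eq: "?F x = (\<Prod>n\<in>{2..M}. c n) * ?F u"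
    by (simp add: vec_nrm2_smult c_def prod_nonneg vec_nrm2_nonneg del: upt_Suc)
  show ?thesis
  \<comment> \<open>If some argument vanishes, both sides are 0; otherwise all \<open>u n\<close>
    are unit vectors and compete in the supremum.\<close>
  proof (cases "\<exists>n\<in>{2..M}. c n = 0")
    case True
    then have zero: "(\<Prod>n\<in>{2..M}. vec_nrm2 (x n)) = 0" by (auto simp: c_def)
    show ?thesis
      using eq unfolding c_def zero by simp
  next
    case False
    then have "vec_nrm2 (u n) = 1" if "n \<in> {2..M}" for n
      using that by (auto simp: u_def vec_nrm2_smult c_def vec_nrm2_nonneg abs_of_nonneg)
    moreover have "u n \<in> carrier_vec (d n)" if "n \<in> {2..M}" for n
      using assms that by (simp add: u_def)
    ultimately have "?F u \<le> tensor_spectral_norm M d T"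
      unfolding tensor_spectral_norm_def
      by (intro cSup_upper bdd_above_tensor_spectral_norm) blast
    then have "(\<Prod>n\<in>{2..M}. c n) * ?F u \<le> (\<Prod>n\<in>{2..M}. c n) * tensor_spectral_norm M d T"
      by (intro mult_left_mono prod_nonneg) (simp_all add: c_def vec_nrm2_nonneg)
    then show ?thesis
      unfolding eq by (simp add: c_def mult.commute[of _ "tensor_spectral_norm M d T"])
  qed
qed

text \<open>Positive dimensions provide unit vectors, so the supremum is at least the norm of one
  contraction. With a zero dimension among modes 2 to \<open>M\<close> it would be taken over the
  empty set.\<close>

lemma tensor_spectral_norm_nonneg:
  assumes "\<And>n. n \<in> {2..M} \<Longrightarrow> d n > 0"
  shows "0 \<le> tensor_spectral_norm M d T"
proof -
  have unit: "vec_nrm2 (unit_vec (d n) 0) = 1" if "n \<in> {2..M}" for n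
    using assms[OF that] by (simp add: vec_nrm2_def)
  show ?thesis
    using vec_nrm2_mode_contracts_le[of M "\<lambda>n. unit_vec (d n) 0" d T] unit
      vec_nrm2_nonneg order_trans by (fastforce simp del: upt_Suc)
qed

section \<open>Exchanging the arguments of a multilinear map\<close>

lemma mode_contracts_perturbation:
  assumes x: "\<And>n. n \<in> {2..M} \<Longrightarrow> x n \<in> carrier_vec (d n) \<and> vec_nrm2 (x n) = 1"
    and y: "\<And>n. n \<in> {2..M} \<Longrightarrow> y n \<in> carrier_vec (d n) \<and> vec_nrm2 (y n) = 1"
    and e: "\<And>n. n \<in> {2..M} \<Longrightarrow> vec_nrm2 (y n - x n) \<le> e"
    and S: "0 \<le> tensor_spectral_norm M d T"
  shows "vec_nrm2 (mode1_fiber (d 1) (mode_contracts T [2..<Suc M] y) (\<lambda>_. undefined)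
      - mode1_fiber (d 1) (mode_contracts T [2..<Suc M] x) (\<lambda>_. undefined))
    \<le> real (M - 1) * e * tensor_spectral_norm M d T"
proof -
  let ?ns = "[2..<Suc M]"
  let ?F = "\<lambda>x. mode1_fiber (d 1) (mode_contracts T ?ns x) (\<lambda>_. undefined)"
  let ?S = "tensor_spectral_norm M d T"
  \<comment> \<open>Induction over the set \<open>K\<close> of modes already switched from
    \<open>x\<close> to \<open>y\<close>; each further mode adds at most
    \<open>e * ?S\<close>.\<close>
  have "vec_nrm2 (?F (override_on x y K) - ?F x) \<le> real (card K) * e * ?S"
    if "K \<subseteq> {2..M}" for K
    using finite_subset[OF that finite_atLeastAtMost] that
  proof (induction K rule: finite_induct)
    case empty
    then show ?case
      by (simp add: vec_nrm2_L2_set L2_set_def mode1_fiber_def del: upt_Suc)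
  next
    case (insert n K)
    let ?z = "override_on x y K"
    have n: "n \<in> {2..M}" using insert.prems by simp
    have z: "?z k \<in> carrier_vec (d k) \<and> vec_nrm2 (?z k) = 1" if "k \<in> {2..M}" for k
      using x y that by (auto simp: override_on_def)
    \<comment> \<open>Writing \<open>y n\<close> as \<open>x n\<close> plus the difference lets
      additivity in mode \<open>n\<close> split off a single term carrying the difference.\<close>
    have upd: "override_on x y (insert n K) = ?z(n := x n + (y n - x n))" "?z(n := x n) = ?z"
      using x[OF n] y[OF n] insert.hyps by (auto simp: override_on_def fun_eq_iff)
    have "?F (override_on x y (insert n K)) - ?F x = (?F ?z - ?F x) + ?F (?z(n := y n - x n))"
      unfolding upd(1) using x[OF n] y[OF n] n upd(2)
      by (intro eq_vecI) (simp_all add: mode1_fiber_def mode_contracts_add del: upt_Suc)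
    then have "vec_nrm2 (?F (override_on x y (insert n K)) - ?F x)
        \<le> vec_nrm2 (?F ?z - ?F x) + vec_nrm2 (?F (?z(n := y n - x n)))"
      by (simp add: vec_nrm2_triangle mode1_fiber_def del: upt_Suc)
    moreover have "vec_nrm2 (?F (?z(n := y n - x n))) \<le> ?S * e"
    proof -
      \<comment> \<open>All arguments other than the one in mode \<open>n\<close> are unit vectors,
        so only the norm of the difference survives in the product.\<close>
      have "(\<Prod>k\<in>{2..M}. vec_nrm2 ((?z(n := y n - x n)) k))
          = vec_nrm2 (y n - x n) * (\<Prod>k\<in>{2..M} - {n}. vec_nrm2 (?z k))"
        using n by (simp add: prod.remove)
      also have "\<dots> = vec_nrm2 (y n - x n)"
        using z by simp
      finally have "vec_nrm2 (?F (?z(n := y n - x n))) \<le> ?S * vec_nrm2 (y n - x n)"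
        using vec_nrm2_mode_contracts_le[of M "?z(n := y n - x n)" d T] x[OF n] y[OF n] z
        by (auto simp del: upt_Suc)
      then show ?thesis
        using mult_left_mono[OF e[OF n] S] by linarith
    qed
    ultimately show ?case
      using insert by (simp add: algebra_simps del: upt_Suc)
  qed
  from this[of "{2..M}"] have "vec_nrm2 (?F (override_on x y {2..M}) - ?F x)
      \<le> real (M - 1) * e * ?S"
    by (simp del: upt_Suc)
  \<comment> \<open>Outside \<open>{2..M}\<close> the overridden family still agrees with
    \<open>x\<close>, but the contractions only read the modes in \<open>?ns\<close>.\<close>
  moreover have "mode_contracts T ?ns (override_on x y {2..M}) = mode_contracts T ?ns y"
    by (rule mode_contracts_cong) auto
  ultimately show ?thesis by simp
qed

section \<open>Both updates as values of one multilinear map, and the error bound\<close>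

lemma mode1_fiber_J1N:
  assumes "2 \<le> N" "i \<in> {2..N} \<rightarrow>\<^sub>E {..<R}"
    and A: "\<And>n. n \<in> {2..<N} \<Longrightarrow> dim_col (A n) = R" and D: "dim_col D = R"
  shows "mode1_fiber s (J1N N X A D) i
    = mode1_fiber s (mode_contracts (mode_contract X N (col D (i N))) [2..<N]
        (\<lambda>n. col (A n) (i n))) (\<lambda>_. undefined)"
proof (rule eq_vecI)
  fix r assume "r < dim_vec (mode1_fiber s (mode_contracts (mode_contract X N (col D (i N)))
      [2..<N] (\<lambda>n. col (A n) (i n))) (\<lambda>_. undefined))"
  then have r: "r < s" by (simp add: mode1_fiber_def)
  have i: "i n < R" if "n \<in> {2..N}" for n
    using assms(2) that by auto
  let ?i = "i(1 := r)"
  let ?u = "(\<lambda>_. undefined)(1 := r)"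
  let ?x = "\<lambda>n. col (A n) (i n)"
  \<comment> \<open>Mode \<open>N\<close> lies outside \<open>[2..<N]\<close>, so setting its index
    to \<open>t\<close> does not affect the selected columns.\<close>
  have x: "mode_contracts X [2..<N] (\<lambda>n. col (A n) ((?i(N := t)) n)) = mode_contracts X [2..<N] ?x"
    for t
    by (rule mode_contracts_cong) auto
  have Y: "Y1N N X A (?i(N := t)) = mode_contracts X [2..<N] ?x (?i(N := t))" for t
    unfolding Y1N_def
    using i A by (subst mode_prods_transpose_eq_contracts) (auto simp: x[simplified])
  have "J1N N X A D ?i = mode_contract (Y1N N X A) N (col D (i N)) ?i"
    using assms(1) i[of N] D by (simp add: J1N_def mode_prod_transpose)
  also have "\<dots> = mode_contracts X ([2..<N] @ [N]) (?x(N := col D (i N))) ?i"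
    using mode_contracts_cong[of "[2..<N]" ?x "?x(N := col D (i N))" X] Y
    by (simp add: mode_contract_def)
  \<comment> \<open>Modes 2 to \<open>N\<close> are all contracted, mode 1 holds \<open>r\<close> in
    both indices, and elsewhere the extensional \<open>i\<close> is already
    \<open>undefined\<close>.\<close>
  also have "\<dots> = mode_contracts X ([2..<N] @ [N]) (?x(N := col D (i N))) ?u"
    using assms(1,2) by (intro mode_contracts_index_cong) (auto simp: PiE_def extensional_def)
  \<comment> \<open>The contraction in mode \<open>N\<close> is moved from last to first, producing
    the tensor whose spectral norm appears in the bound.\<close>
  also have "\<dots> = mode_contracts (mode_contract X N (col D (i N))) [2..<N] ?x ?u"
    using mode_contracts_cong[of "[2..<N]" ?x "?x(N := col D (i N))"
        "mode_contract X N (col D (i N))"]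
    by (simp add: mode_contract_mode_contracts)
  finally show "mode1_fiber s (J1N N X A D) i $ r
    = mode1_fiber s (mode_contracts (mode_contract X N (col D (i N))) [2..<N] ?x)
        (\<lambda>_. undefined) $ r"
    using r by (simp add: mode1_fiber_def)
qed (simp add: mode1_fiber_def)

theorem theorem4p4:
  shows "\<exists>C>0. \<exists>c>0.
    \<forall>(N::nat) (s::nat) (R::nat) (X::tensor)
     (A :: nat \<Rightarrow> real mat) (A\<^sub>p :: nat \<Rightarrow> real mat) (dA :: nat \<Rightarrow> real mat)
     (A\<^sub>n\<^sub>e\<^sub>w :: real mat) (\<delta>A :: real mat) (\<epsilon>::real).
      2 \<le> N \<longrightarrow>
      (\<forall>n\<in>{1..N}.
         A n \<in> carrier_mat s R \<and> A\<^sub>p n \<in> carrier_mat s R \<and> dA n \<in> carrier_mat s R \<and>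
         A n = A\<^sub>p n + dA n \<and> orthonormal_cols (A n) \<and> orthonormal_cols (A\<^sub>p n)) \<longrightarrow>
      tucker_als_update N s R X A N A\<^sub>n\<^sub>e\<^sub>w \<longrightarrow>
      \<delta>A = A\<^sub>n\<^sub>e\<^sub>w - A N \<longrightarrow>
      (\<forall>n\<in>{1..N}. \<forall>k<R. vec_nrm2 (col (dA n) k) / vec_nrm2 (col (A n) k) \<le> \<epsilon>) \<longrightarrow>
      \<epsilon> < 1 \<longrightarrow>
      real N * \<epsilon> \<le> c \<longrightarrow>
      (\<forall>i \<in> {2..N} \<rightarrow>\<^sub>E {..<R}.
         vec_nrm2 (mode1_fiber s (J1N N X A\<^sub>p \<delta>A) i - mode1_fiber s (J1N N X A \<delta>A) i)
         \<le> C * (real N * \<epsilon>)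
            * tensor_spectral_norm (N - 1) (\<lambda>_. s) (mode_contract X N (col \<delta>A (i N)))
            * (\<Prod>j\<in>{2..<N}. vec_nrm2 (col (A j) (i j))))"
\<comment> \<open>The witness 1 is supplied for both \<open>C\<close> and \<open>c\<close>;
  \<open>C = 1\<close> suffices because the \<open>N - 2\<close> exchanges cost at most \<epsilon>
  times the spectral norm each.\<close>
proof (intro exI[of _ "1::real"] conjI allI impI ballI)
  fix N s R :: nat and X :: tensor and A A\<^sub>p dA :: "nat \<Rightarrow> real mat"
    and A\<^sub>n\<^sub>e\<^sub>w \<delta>A :: "real mat" and \<epsilon> :: real and i :: "nat \<Rightarrow> nat"
  assume N: "2 \<le> N"
    and factors: "\<forall>n\<in>{1..N}. A n \<in> carrier_mat s R \<and> A\<^sub>p n \<in> carrier_mat s R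
      \<and> dA n \<in> carrier_mat s R \<and> A n = A\<^sub>p n + dA n
      \<and> orthonormal_cols (A n) \<and> orthonormal_cols (A\<^sub>p n)"
    and als: "tucker_als_update N s R X A N A\<^sub>n\<^sub>e\<^sub>w"
    and \<delta>A: "\<delta>A = A\<^sub>n\<^sub>e\<^sub>w - A N"
    and \<epsilon>: "\<forall>n\<in>{1..N}. \<forall>k<R. vec_nrm2 (col (dA n) k) / vec_nrm2 (col (A n) k) \<le> \<epsilon>"
    and i: "i \<in> {2..N} \<rightarrow>\<^sub>E {..<R}"
  let ?T = "mode_contract X N (col \<delta>A (i N))"
  let ?S = "tensor_spectral_norm (N - 1) (\<lambda>_. s) ?T"
  have upt: "[2..<N] = [2..<Suc (N - 1)]" using N by simp
  have iR: "i n < R" if "n \<in> {2..N}" for n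
    using i that by auto
  \<comment> \<open>The mode-\<open>N\<close> unfolding has \<open>s\<close> rows, and
    \<open>R\<close> leading left singular vectors are taken from it. With \<open>i N < R\<close>
    this gives \<open>0 < s\<close>, so the spectral norm is nonnegative.\<close>
  have "R \<le> s"
    using als
    by (auto simp: tucker_als_update_def leading_left_singular_vectors_def mode_unfolding_def)
  then have "0 < s" using iR[of N] N by auto
  then have S: "0 \<le> ?S" by (intro tensor_spectral_norm_nonneg)
  have unit: "vec_nrm2 (col (A n) k) = 1" "vec_nrm2 (col (A\<^sub>p n) k) = 1"
    if "n \<in> {1..N}" "k < R" for n k
  proof -
    from factors that have "A n \<in> carrier_mat s R" "A\<^sub>p n \<in> carrier_mat s R"
      "orthonormal_cols (A n)" "orthonormal_cols (A\<^sub>p n)"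
      by blast+
    then show "vec_nrm2 (col (A n) k) = 1" "vec_nrm2 (col (A\<^sub>p n) k) = 1"
      using that(2) by (simp_all add: orthonormal_cols_vec_nrm2_col)
  qed
  \<comment> \<open>The columns of \<open>A n\<close> are unit vectors, so the relative bound is an
    absolute one; the difference is minus a column of \<open>dA n\<close>.\<close>
  have e: "vec_nrm2 (col (A\<^sub>p n) k - col (A n) k) \<le> \<epsilon>" if "n \<in> {1..N}" "k < R" for n k
  proof -
    have "col (A\<^sub>p n) k - col (A n) k = (-1) \<cdot>\<^sub>v col (dA n) k"
    proof -
      from factors that have "A\<^sub>p n \<in> carrier_mat s R" "dA n \<in> carrier_mat s R"
        "A n = A\<^sub>p n + dA n"
        by blast+
      then show ?thesis
        using that(2) by (intro eq_vecI) auto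
    qed
    moreover have "vec_nrm2 (col (dA n) k) / vec_nrm2 (col (A n) k) \<le> \<epsilon>"
      using \<epsilon> that by blast
    ultimately show ?thesis
      using unit(1)[OF that] by (simp add: vec_nrm2_smult)
  qed
  \<comment> \<open>The sign of \<epsilon> follows from its bounding a norm, here in mode 1 at
    column \<open>i N\<close>.\<close>
  have "0 \<le> \<epsilon>"
    using order_trans[OF vec_nrm2_nonneg e[of 1 "i N"]] N iR[of N] by simp
  have dims: "dim_col \<delta>A = R" "\<And>n. n \<in> {2..<N} \<Longrightarrow> dim_col (A n) = R"
    "\<And>n. n \<in> {2..<N} \<Longrightarrow> dim_col (A\<^sub>p n) = R"
  proof -
    have "dim_col (A n) = R \<and> dim_col (A\<^sub>p n) = R" if "n \<in> {1..N}" for n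
      using factors that by (blast dest: carrier_matD(2))
    then show "dim_col \<delta>A = R" "\<And>n. n \<in> {2..<N} \<Longrightarrow> dim_col (A n) = R"
      "\<And>n. n \<in> {2..<N} \<Longrightarrow> dim_col (A\<^sub>p n) = R"
      using N by (simp_all add: \<delta>A)
  qed
  have J: "mode1_fiber s (J1N N X A \<delta>A) i
      = mode1_fiber s (mode_contracts ?T [2..<N] (\<lambda>n. col (A n) (i n))) (\<lambda>_. undefined)"
    "mode1_fiber s (J1N N X A\<^sub>p \<delta>A) i
      = mode1_fiber s (mode_contracts ?T [2..<N] (\<lambda>n. col (A\<^sub>p n) (i n))) (\<lambda>_. undefined)"
    using mode1_fiber_J1N[OF N i] dims by blast+
  \<comment> \<open>\<open>?T\<close> has order \<open>N - 1\<close> and its mode 1 stays free,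
    which leaves \<open>N - 1 - 1\<close> arguments to exchange.\<close>
  have "vec_nrm2 (mode1_fiber s (J1N N X A\<^sub>p \<delta>A) i - mode1_fiber s (J1N N X A \<delta>A) i)
      \<le> real (N - 1 - 1) * \<epsilon> * ?S"
    unfolding J upt
  proof (rule mode_contracts_perturbation[where d = "\<lambda>_. s"])
    fix n assume "n \<in> {2..N - 1}"
    then have n: "n \<in> {1..N}" "i n < R" using iR[of n] by auto
    with factors have "A n \<in> carrier_mat s R" "A\<^sub>p n \<in> carrier_mat s R" by blast+
    then have carrier: "col (A n) (i n) \<in> carrier_vec s" "col (A\<^sub>p n) (i n) \<in> carrier_vec s"
      by (simp_all add: carrier_vecI)
    show "col (A n) (i n) \<in> carrier_vec s \<and> vec_nrm2 (col (A n) (i n)) = 1"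
      using carrier(1) unit(1)[OF n] ..
    show "col (A\<^sub>p n) (i n) \<in> carrier_vec s \<and> vec_nrm2 (col (A\<^sub>p n) (i n)) = 1"
      using carrier(2) unit(2)[OF n] ..
    show "vec_nrm2 (col (A\<^sub>p n) (i n) - col (A n) (i n)) \<le> \<epsilon>"
      using e[OF n] .
  qed (rule S)
  also have "\<dots> \<le> real N * \<epsilon> * ?S"
    using S \<open>0 \<le> \<epsilon>\<close> by (intro mult_right_mono) auto
  \<comment> \<open>The product of column norms equals 1 by orthonormality.\<close>
  finally show "vec_nrm2 (mode1_fiber s (J1N N X A\<^sub>p \<delta>A) i - mode1_fiber s (J1N N X A \<delta>A) i)
      \<le> 1 * (real N * \<epsilon>) * ?S * (\<Prod>j\<in>{2..<N}. vec_nrm2 (col (A j) (i j)))"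
    using unit iR by simp
qed simp_all

end
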